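(* Let $(X,\mathcal{A})$ be a measurable space and let $S(X,\mathcal{A})$ be a $\chi$-ring. Each maximal ideal in $S(X,\mathcal{A})$ is a $\mathcal{Z}_S$-ideal if and only if $S(X,\mathcal{A})$ is a Gelfand ring.
   Context: A measurable space $(X,\mathcal{A})$ is a nonempty set $X$ with a $\sigma$-algebra $\mathcal{A}$ of subsets of $X$. $\mathcal{M}(X,\mathcal{A})$ is the commutative ring (pointwise operations) of all $\mathcal{A}$-measurable functions $X\to\mathbb{R}$. A $\chi$-ring $S(X,\mathcal{A})$ is a subring of $\mathcal{M}(X,\mathcal{A})$ such that $\chi_A\in S(X,\mathcal{A})$ for every $A\in\mathcal{A}$, where $\chi_A$ is the characteristic function of $A$. "Ideal" always means proper ideal. For $f\in S(X,\mathcal{A})$, $\mathcal{Z}_S(f)=\{E\in\mathcal{A}: \text{there exists } g\in S(X,\mathcal{A}) \text{ with } f(x)g(x)=1 \text{ for all } x\in X\setminus E\}$; for an ideal $I$, $\mathcal{Z}_S[I]=\bigcup_{f\in I}\mathcal{Z}_S(f)$. An ideal $I$ in $S(X,\mathcal{A})$ is a $\mathcal{Z}_S$-ideal if for any $f\in S(X,\mathcal{A})$, $\mathcal{Z}_S(f)\subseteq\mathcal{Z}_S[I]$ implies $f\in I$. A commutative ring with unity is Gelfand if every prime ideal is contained in a unique maximal ideal. *)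

theory Defs
  imports "HOL-Algebra.Subrings" "HOL-Algebra.Ideal" "HOL-Analysis.Borel_Space"
begin

text \<open>
  A measurable space is represented by a value \<open>M :: 'a measure\<close>, of which only
  \<open>space M\<close> and \<open>sets M\<close> are used. Functions on \<open>space M\<close> are represented as
  extensional functions (\<open>undefined\<close> outside \<open>space M\<close>), so that equality in the
  ring is equality of functions on \<open>space M\<close>.
\<close>

definition measurable_function_ring :: "'a measure \<Rightarrow> ('a \<Rightarrow> real) ring" where
  "measurable_function_ring M =
     \<lparr>carrier = borel_measurable M \<inter> extensional (space M),
      monoid.mult = (\<lambda>f g. \<lambda>x\<in>space M. f x * g x),
      one = (\<lambda>x\<in>space M. 1),
      zero = (\<lambda>x\<in>space M. 0),
      add = (\<lambda>f g. \<lambda>x\<in>space M. f x + g x)\<rparr>"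

definition chi_ring :: "'a measure \<Rightarrow> ('a \<Rightarrow> real) set \<Rightarrow> bool" where
  "chi_ring M S \<longleftrightarrow>
     subring S (measurable_function_ring M) \<and>
     (\<forall>A\<in>sets M. restrict (indicator A) (space M) \<in> S)"

abbreviation ring_on :: "'a measure \<Rightarrow> ('a \<Rightarrow> real) set \<Rightarrow> ('a \<Rightarrow> real) ring" where
  "ring_on M S \<equiv> (measurable_function_ring M)\<lparr>carrier := S\<rparr>"

definition Z_sets :: "'a measure \<Rightarrow> ('a \<Rightarrow> real) set \<Rightarrow> ('a \<Rightarrow> real) \<Rightarrow> 'a set set" where
  "Z_sets M S f = {E \<in> sets M. \<exists>g\<in>S. \<forall>x\<in>space M - E. f x * g x = 1}"

definition Z_family :: "'a measure \<Rightarrow> ('a \<Rightarrow> real) set \<Rightarrow> ('a \<Rightarrow> real) set \<Rightarrow> 'a set set" where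
  "Z_family M S I = (\<Union>f\<in>I. Z_sets M S f)"

text \<open>Ideals are proper here; the library predicate \<^const>\<open>ideal\<close> admits the whole ring.\<close>

definition Z_ideal :: "'a measure \<Rightarrow> ('a \<Rightarrow> real) set \<Rightarrow> ('a \<Rightarrow> real) set \<Rightarrow> bool" where
  "Z_ideal M S I \<longleftrightarrow>
     ideal I (ring_on M S) \<and> I \<noteq> S \<and>
     (\<forall>f\<in>S. Z_sets M S f \<subseteq> Z_family M S I \<longrightarrow> f \<in> I)"

definition gelfand_ring :: "('a, 'b) ring_scheme \<Rightarrow> bool" where
  "gelfand_ring R \<longleftrightarrow>
     cring R \<and> (\<forall>P. primeideal P R \<longrightarrow> (\<exists>!N. maximalideal N R \<and> P \<subseteq> N))"

lemma restrict_borel_measurable_iff: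
  "restrict f (space M) \<in> borel_measurable M \<longleftrightarrow> f \<in> borel_measurable M"
  by (rule measurable_cong) simp

lemma cring_measurable_function_ring: "cring (measurable_function_ring M)"
proof (intro cringI abelian_groupI comm_monoidI)
  fix f assume f: "f \<in> carrier (measurable_function_ring M)"
  then show "\<exists>g\<in>carrier (measurable_function_ring M).
      g \<oplus>\<^bsub>measurable_function_ring M\<^esub> f = \<zero>\<^bsub>measurable_function_ring M\<^esub>"
    by (intro bexI[of _ "\<lambda>x\<in>space M. - f x"])
       (auto simp: measurable_function_ring_def restrict_borel_measurable_iff
          intro!: restrict_ext)
qed (auto simp: measurable_function_ring_def restrict_borel_measurable_iff extensional_def
      algebra_simps restrict_def intro!: ext)

lemma cring_ring_on:
  assumes "chi_ring M S"
  shows "cring (ring_on M S)"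
proof -
  interpret R: cring "measurable_function_ring M"
    by (rule cring_measurable_function_ring)
  have S: "subring S (measurable_function_ring M)"
    using assms by (simp add: chi_ring_def)
  show ?thesis
    using R.subcring_iff[OF subringE(1)[OF S]] R.subcringI'[OF S] by blast
qed

end

theory Submission
  imports Defs "HOL-Algebra.Ring_Divisibility"
begin

text \<open>
  A set \<open>E\<close> lies in \<open>\<Z>\<^sub>S(f)\<close> iff the idempotent \<open>\<chi>\<close> of its complement is a multiple of \<open>f\<close>. So a
  maximal ideal \<open>N\<close> is a \<open>\<Z>\<^sub>S\<close>-ideal iff each \<open>f \<notin> N\<close> divides an idempotent outside \<open>N\<close>. If
  this holds for all \<open>N\<close>, such an idempotent separates any two maximal ideals above a prime \<open>P\<close>,
  since \<open>P\<close> contains \<open>e\<close> or \<open>1 - e\<close>. Conversely, in a Gelfand ring comaximal ideals \<open>(f)\<close> and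
  \<open>N\<close> admit \<open>u \<in> 1 + (f)\<close> and \<open>v \<in> 1 + N\<close> with \<open>u v = 0\<close>: otherwise a prime ideal disjoint from
  all these products would lie in two different maximal ideals. The characteristic function of
  \<open>{v \<noteq> 0}\<close> is then a multiple of \<open>f\<close>, because \<open>u = 0\<close> there, and it is not in \<open>N\<close>, because it
  divides \<open>v\<close>.
\<close>

section \<open>Ideals avoiding a set: maximal and prime ideals\<close>

text \<open>Zorn's lemma with \<open>T\<close> left arbitrary: \<open>T = {\<one>}\<close> leads to
  maximal ideals, a multiplicative \<open>T\<close> to prime ideals.\<close>

lemma (in ring) exists_ideal_maximal_disjoint:
  assumes I: "ideal I R" and disj: "I \<inter> T = {}"
  obtains P where "ideal P R" "I \<subseteq> P" "P \<inter> T = {}"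
    "\<And>J. ideal J R \<Longrightarrow> P \<subseteq> J \<Longrightarrow> J \<inter> T = {} \<Longrightarrow> J = P"
proof -
  let ?F = "{J. ideal J R \<and> I \<subseteq> J \<and> J \<inter> T = {}}"
  have "\<exists>P\<in>?F. \<forall>J\<in>?F. P \<subseteq> J \<longrightarrow> J = P"
  proof (rule subset_Zorn_nonempty)
    show "?F \<noteq> {}" using assms by blast
    fix C assume C: "C \<noteq> {}" "subset.chain ?F C"
    \<comment> \<open>Only being a chain of ideals matters for the union to be an ideal. The
      conditions on \<open>I\<close> and \<open>T\<close> pass to the union because \<open>C\<close>
      is a nonempty part of \<open>?F\<close>.\<close>
    then have "subset.chain {J. ideal J R} C"
      unfolding pred_on.chain_def by blast
    then have "ideal (\<Union>C) R"
      using chain_Union_is_ideal[of C] C(1) by simp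
    moreover have "C \<subseteq> ?F"
      using C(2) unfolding pred_on.chain_def by blast
    ultimately show "\<Union>C \<in> ?F"
      using C(1) by blast
  qed
  then show thesis
    using that by (smt (verit) mem_Collect_eq order_trans)
qed

text \<open>Proper ideals are exactly those avoiding \<one>, so an ideal maximal under that
  condition is a maximal ideal.\<close>

lemma (in ring) exists_maximalideal:
  assumes I: "ideal I R" and proper: "I \<noteq> carrier R"
  obtains N where "maximalideal N R" "I \<subseteq> N"
proof -
  have one_iff: "J \<inter> {\<one>} = {} \<longleftrightarrow> J \<noteq> carrier R" if "ideal J R" for J
    using ideal.one_imp_carrier[OF that] by auto
  obtain N where N: "ideal N R" "I \<subseteq> N" "N \<inter> {\<one>} = {}"
    "\<And>J. ideal J R \<Longrightarrow> N \<subseteq> J \<Longrightarrow> J \<inter> {\<one>} = {} \<Longrightarrow> J = N"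
    using exists_ideal_maximal_disjoint[OF I, of "{\<one>}"] one_iff[OF I] proper by metis
  have "maximalideal N R"
    by (rule maximalidealI) (use N one_iff in auto)
  then show thesis using that N(2) by blast
qed

lemma (in ring) mem_add_idealsE:
  assumes "x \<in> I <+>\<^bsub>R\<^esub> J"
  obtains i j where "i \<in> I" "j \<in> J" "x = i \<oplus> j"
  using assms by (auto simp: set_add_def')

lemma (in ring) subset_add_ideals:
  assumes "ideal I R" "ideal J R"
  shows "I \<subseteq> I <+>\<^bsub>R\<^esub> J" "J \<subseteq> I <+>\<^bsub>R\<^esub> J"
proof -
  interpret I: ideal I R by fact
  interpret J: ideal J R by fact
  have "i \<in> I <+>\<^bsub>R\<^esub> J" if "i \<in> I" for i
  proof -
    have "i \<oplus> \<zero> \<in> I <+>\<^bsub>R\<^esub> J"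
      unfolding set_add_def' using that J.zero_closed by blast
    then show ?thesis using I.Icarr[OF that] by simp
  qed
  then show "I \<subseteq> I <+>\<^bsub>R\<^esub> J" by blast
  have "j \<in> I <+>\<^bsub>R\<^esub> J" if "j \<in> J" for j
  proof -
    have "\<zero> \<oplus> j \<in> I <+>\<^bsub>R\<^esub> J"
      unfolding set_add_def' using that I.zero_closed by blast
    then show ?thesis using J.Icarr[OF that] by simp
  qed
  then show "J \<subseteq> I <+>\<^bsub>R\<^esub> J" by blast
qed

text \<open>Krull's argument: an ideal maximal among those missing a multiplicative set is
  prime.\<close>

lemma (in cring) exists_primeideal_disjoint:
  assumes one: "\<one> \<in> T"
    and mult: "\<And>s t. s \<in> T \<Longrightarrow> t \<in> T \<Longrightarrow> s \<otimes> t \<in> T"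
    and zero: "\<zero> \<notin> T"
  obtains P where "primeideal P R" "P \<inter> T = {}"
proof -
  obtain P where P: "ideal P R" "P \<inter> T = {}"
    and maxP: "\<And>J. ideal J R \<Longrightarrow> P \<subseteq> J \<Longrightarrow> J \<inter> T = {} \<Longrightarrow> J = P"
    by (rule exists_ideal_maximal_disjoint[OF zeroideal, of T]) (use zero in auto)
  interpret P: ideal P R by (rule P(1))
  \<comment> \<open>The ideal P + (a) is strictly larger than \<open>P\<close>, so by maximality it
    meets \<open>T\<close>.\<close>
  have meets: "\<exists>p\<in>P. \<exists>r\<in>carrier R. p \<oplus> r \<otimes> a \<in> T" if a: "a \<in> carrier R" "a \<notin> P" for a
  proof -
    have I: "ideal (PIdl a) R" by (rule cgenideal_ideal[OF a(1)])
    have "P <+>\<^bsub>R\<^esub> PIdl a \<noteq> P"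
      using subset_add_ideals(2)[OF P(1) I] cgenideal_self[OF a(1)] a(2) by blast
    then have "(P <+>\<^bsub>R\<^esub> PIdl a) \<inter> T \<noteq> {}"
      using maxP[OF add_ideals[OF P(1) I] subset_add_ideals(1)[OF P(1) I]] by blast
    then show ?thesis
      by (auto simp: set_add_def' cgenideal_def)
  qed
  have "primeideal P R"
  proof (rule primeidealI[OF P(1) is_cring])
    show "carrier R \<noteq> P" using P(2) one by auto
    fix a b assume a: "a \<in> carrier R" and b: "b \<in> carrier R" and ab: "a \<otimes> b \<in> P"
    show "a \<in> P \<or> b \<in> P"
    proof (rule ccontr)
      assume "\<not> (a \<in> P \<or> b \<in> P)"
      then obtain p r q s where pr: "p \<in> P" "r \<in> carrier R" "p \<oplus> r \<otimes> a \<in> T"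
        and qs: "q \<in> P" "s \<in> carrier R" "q \<oplus> s \<otimes> b \<in> T"
        using meets a b by meson
      have pq: "p \<in> carrier R" "q \<in> carrier R"
        using pr(1) qs(1) P.Icarr by auto
      \<comment> \<open>After expansion every term has a factor \<open>p\<close>, \<open>q\<close>
        or \<open>a \<otimes> b\<close>, all in \<open>P\<close>.\<close>
      have "(p \<oplus> r \<otimes> a) \<otimes> (q \<oplus> s \<otimes> b)
          = p \<otimes> (q \<oplus> s \<otimes> b) \<oplus> (q \<otimes> (r \<otimes> a) \<oplus> (r \<otimes> s) \<otimes> (a \<otimes> b))"
        using pq pr(2) qs(2) a b by algebra
      also have "\<dots> \<in> P"
        using P.I_r_closed[OF pr(1), of "q \<oplus> s \<otimes> b"] P.I_r_closed[OF qs(1), of "r \<otimes> a"]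
          P.I_l_closed[OF ab, of "r \<otimes> s"] pq pr(2) qs(2) a b
        by (simp add: P.a_closed)
      finally show False
        using mult[OF pr(3) qs(3)] P(2) by blast
    qed
  qed
  then show thesis using that P(2) by blast
qed

section \<open>Comaximal ideals and idempotents in Gelfand rings\<close>

text \<open>Both factors are 1 modulo \<open>I\<close>. Membership in the coset 1 + I is written
  \<open>u \<oplus> i = \<one>\<close> to avoid subtraction.\<close>

lemma (in ring) mult_complements_of_ideal:
  assumes I: "ideal I R" and u: "u \<in> carrier R" "i \<in> I" "u \<oplus> i = \<one>"
    and v: "v \<in> carrier R" "j \<in> I" "v \<oplus> j = \<one>"
  shows "\<exists>k\<in>I. u \<otimes> v \<oplus> k = \<one>"
proof
  interpret I: ideal I R by fact
  have ij: "i \<in> carrier R" "j \<in> carrier R" using u v I.Icarr by auto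
  show "u \<otimes> j \<oplus> i \<in> I" using u v by (intro I.a_closed I.I_l_closed)
  have "u \<otimes> v \<oplus> (u \<otimes> j \<oplus> i) = u \<otimes> (v \<oplus> j) \<oplus> i"
    using u(1) v(1) ij by (simp add: r_distr a_assoc)
  then show "u \<otimes> v \<oplus> (u \<otimes> j \<oplus> i) = \<one>"
    using u v by simp
qed

text \<open>A failure would make the products of 1 + I with 1 + J a multiplicative set missing 0. A
  prime avoiding it extends to a maximal ideal above \<open>I\<close> and to one above
  \<open>J\<close>; the Gelfand property identifies these two although I + J contains 1.\<close>

lemma (in cring) gelfand_comaximal:
  assumes gelfand: "gelfand_ring R"
    and I: "ideal I R" and J: "ideal J R" and IJ: "\<one> \<in> I <+>\<^bsub>R\<^esub> J"
  obtains u i v j where "u \<in> carrier R" "i \<in> I" "u \<oplus> i = \<one>"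
    "v \<in> carrier R" "j \<in> J" "v \<oplus> j = \<one>" "u \<otimes> v = \<zero>"
proof (cases "\<exists>u\<in>carrier R. \<exists>v\<in>carrier R. (\<exists>i\<in>I. u \<oplus> i = \<one>) \<and> (\<exists>j\<in>J. v \<oplus> j = \<one>) \<and> u \<otimes> v = \<zero>")
  case True
  then show thesis using that by blast
next
  case False
  interpret I: ideal I R by fact
  interpret J: ideal J R by fact
  define T where "T = {u \<otimes> v | u v. u \<in> carrier R \<and> v \<in> carrier R
    \<and> (\<exists>i\<in>I. u \<oplus> i = \<one>) \<and> (\<exists>j\<in>J. v \<oplus> j = \<one>)}"
  have one: "\<exists>i\<in>I. \<one> \<oplus> i = \<one>" "\<exists>j\<in>J. \<one> \<oplus> j = \<one>"
    using I.zero_closed J.zero_closed by auto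
  \<comment> \<open>Taking \<one> as the other factor places both cosets inside
    \<open>T\<close>.\<close>
  have TI: "u \<in> T" if "u \<in> carrier R" "\<exists>i\<in>I. u \<oplus> i = \<one>" for u
    unfolding T_def mem_Collect_eq
    by (intro exI[of _ u] exI[of _ \<one>]) (use that one in auto)
  have TJ: "v \<in> T" if "v \<in> carrier R" "\<exists>j\<in>J. v \<oplus> j = \<one>" for v
    unfolding T_def mem_Collect_eq
    by (intro exI[of _ \<one>] exI[of _ v]) (use that one in auto)
  have mult: "s \<otimes> t \<in> T" if s: "s \<in> T" and t: "t \<in> T" for s t
  proof -
    obtain u v where uv: "s = u \<otimes> v" "u \<in> carrier R" "v \<in> carrier R"
      "\<exists>i\<in>I. u \<oplus> i = \<one>" "\<exists>j\<in>J. v \<oplus> j = \<one>"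
      using s unfolding T_def by blast
    obtain u' v' where uv': "t = u' \<otimes> v'" "u' \<in> carrier R" "v' \<in> carrier R"
      "\<exists>i\<in>I. u' \<oplus> i = \<one>" "\<exists>j\<in>J. v' \<oplus> j = \<one>"
      using t unfolding T_def by blast
    have "s \<otimes> t = (u \<otimes> u') \<otimes> (v \<otimes> v')"
      using uv(1-3) uv'(1-3) by (simp add: m_ac)
    moreover have "\<exists>i\<in>I. u \<otimes> u' \<oplus> i = \<one>"
      using mult_complements_of_ideal[OF I] uv(2,4) uv'(2,4) by blast
    moreover have "\<exists>j\<in>J. v \<otimes> v' \<oplus> j = \<one>"
      using mult_complements_of_ideal[OF J] uv(3,5) uv'(3,5) by blast
    ultimately show ?thesis
      unfolding T_def mem_Collect_eq
      by (intro exI[of _ "u \<otimes> u'"] exI[of _ "v \<otimes> v'"]) (use uv(2,3) uv'(2,3) in simp)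
  qed
  have "\<zero> \<notin> T" unfolding T_def using False by force
  then obtain P where P: "primeideal P R" "P \<inter> T = {}"
    using exists_primeideal_disjoint[of T] TI[of \<one>] one mult by blast
  interpret P: primeideal P R by (rule P(1))
  \<comment> \<open>From \<one> = p + k it would follow that \<open>p\<close> lies in both
    \<open>P\<close> and \<open>T\<close>. \<open>K\<close> stands for \<open>I\<close> and
    \<open>J\<close> in turn.\<close>
  have proper: "P <+>\<^bsub>R\<^esub> K \<noteq> carrier R"
    if K: "\<And>u. u \<in> carrier R \<Longrightarrow> \<exists>k\<in>K. u \<oplus> k = \<one> \<Longrightarrow> u \<in> T" for K
  proof
    assume "P <+>\<^bsub>R\<^esub> K = carrier R"
    then obtain p k where "p \<in> P" "k \<in> K" "\<one> = p \<oplus> k"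
      using mem_add_idealsE[of \<one> P K] by auto
    then show False using K[of p] P(2) P.Icarr by force
  qed
  obtain N1 where N1: "maximalideal N1 R" "P <+>\<^bsub>R\<^esub> I \<subseteq> N1"
    using exists_maximalideal[OF add_ideals[OF P.is_ideal I] proper[of I]] TI by blast
  obtain N2 where N2: "maximalideal N2 R" "P <+>\<^bsub>R\<^esub> J \<subseteq> N2"
    using exists_maximalideal[OF add_ideals[OF P.is_ideal J] proper[of J]] TJ by blast
  have "N1 = N2"
  proof -
    have "P \<subseteq> N1" "P \<subseteq> N2"
      using N1(2) N2(2) subset_add_ideals(1)[OF P.is_ideal I] subset_add_ideals(1)[OF P.is_ideal J]
      by (meson subset_trans)+
    then show ?thesis
      using gelfand P(1) N1(1) N2(1) unfolding gelfand_ring_def by metis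
  qed
  then have IJ_N1: "I \<subseteq> N1" "J \<subseteq> N1"
    using N1(2) N2(2) subset_add_ideals(2)[OF P.is_ideal I] subset_add_ideals(2)[OF P.is_ideal J]
    by (meson subset_trans, metis subset_trans)
  interpret N1: maximalideal N1 R by (rule N1(1))
  obtain i j where "i \<in> I" "j \<in> J" "\<one> = i \<oplus> j"
    using IJ by (rule mem_add_idealsE)
  then have "\<one> \<in> N1" using IJ_N1 N1.a_closed by auto
  then show thesis using N1.I_notcarr N1.one_imp_carrier by simp
qed

text \<open>The hypothesis \<open>sep\<close> is what the condition on maximal ideals amounts to
  once functions and sets are removed.\<close>

lemma (in cring) gelfand_if_idempotent_separation:
  assumes sep: "\<And>N f. maximalideal N R \<Longrightarrow> f \<in> carrier R \<Longrightarrow> f \<notin> N \<Longrightarrow>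
      \<exists>e\<in>PIdl f. e \<otimes> e = e \<and> e \<notin> N"
  shows "gelfand_ring R"
  unfolding gelfand_ring_def
proof (intro conjI allI impI)
  show "cring R" by (rule is_cring)
  fix P assume P: "primeideal P R"
  interpret P: primeideal P R by (rule P)
  obtain N where N: "maximalideal N R" "P \<subseteq> N"
    using exists_maximalideal[OF P.is_ideal] P.I_notcarr by metis
  show "\<exists>!N. maximalideal N R \<and> P \<subseteq> N"
  proof (rule ex1I[of _ N])
    fix N' assume N': "maximalideal N' R \<and> P \<subseteq> N'"
    interpret N: maximalideal N R by (rule N(1))
    interpret N': maximalideal N' R using N' by simp
    show "N' = N"
    proof (rule ccontr)
      assume "N' \<noteq> N"
      \<comment> \<open>Distinct maximal ideals are not nested; separation is then applied at
        \<open>N'\<close> to an element of \<open>N\<close>.\<close>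
      then have "\<not> N \<subseteq> N'"
        using N.I_maximal[OF N'.is_ideal] N'.I_notcarr N'.a_subset by blast
      then obtain f where f: "f \<in> N" "f \<notin> N'" by blast
      then obtain e where e: "e \<in> PIdl f" "e \<otimes> e = e" "e \<notin> N'"
        using sep[of N' f] N' N.Icarr by blast
      have eN: "e \<in> N" using e(1) cgenideal_minimal[OF N.is_ideal f(1)] by blast
      then have ec: "e \<in> carrier R" by (rule N.Icarr)
      \<comment> \<open>This product is zero, so \<open>P\<close> contains one of its factors. It is
        not \<open>e\<close>, since \<open>P \<subseteq> N'\<close>.\<close>
      have "e \<otimes> (\<one> \<ominus> e) = e \<ominus> e \<otimes> e"
        using ec by algebra
      then have "e \<otimes> (\<one> \<ominus> e) \<in> P"
        using e(2) ec by (simp add: P.zero_closed minus_eq r_neg)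
      then have "\<one> \<ominus> e \<in> N"
        using P.I_prime[of e "\<one> \<ominus> e"] ec N(2) N' e(3) by auto
      moreover have "\<one> = (\<one> \<ominus> e) \<oplus> e" using ec by algebra
      ultimately have "\<one> \<in> N" using eN N.a_closed by metis
      then show False using N.I_notcarr N.one_imp_carrier by simp
    qed
  qed (use N in simp)
qed

section \<open>Characteristic functions in a chi-ring\<close>

lemma ring_on_simps:
  "carrier (ring_on M S) = S"
  "f \<otimes>\<^bsub>ring_on M S\<^esub> g = (\<lambda>x\<in>space M. f x * g x)"
  "f \<oplus>\<^bsub>ring_on M S\<^esub> g = (\<lambda>x\<in>space M. f x + g x)"
  "\<one>\<^bsub>ring_on M S\<^esub> = (\<lambda>x\<in>space M. 1)"
  "\<zero>\<^bsub>ring_on M S\<^esub> = (\<lambda>x\<in>space M. 0)"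
  by (simp_all add: measurable_function_ring_def)

context
  fixes M :: "'a measure" and S :: "('a \<Rightarrow> real) set"
  assumes chi: "chi_ring M S"
begin

interpretation cring "ring_on M S"
  by (rule cring_ring_on[OF chi])

lemma chi_ring_subset: "S \<subseteq> borel_measurable M \<inter> extensional (space M)"
  using chi subringE(1) unfolding chi_ring_def measurable_function_ring_def by fastforce

lemma chi_ring_indicator: "A \<in> sets M \<Longrightarrow> restrict (indicator A) (space M) \<in> S"
  using chi unfolding chi_ring_def by blast

text \<open>On \<open>A\<close> the function \<open>g\<close> inverts \<open>f\<close>; elsewhere
  the indicator kills the product. The bracketing exhibits a left multiple of \<open>f\<close>, as
  \<open>ideal.I_l_closed\<close> requires.\<close>

lemma indicator_eq_mult:
  assumes "A \<subseteq> space M" "\<And>x. x \<in> A \<Longrightarrow> f x * g x = 1"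
  shows "restrict (indicator A) (space M)
    = (g \<otimes>\<^bsub>ring_on M S\<^esub> restrict (indicator A) (space M)) \<otimes>\<^bsub>ring_on M S\<^esub> f"
  using assms unfolding ring_on_simps by (auto simp: indicator_def mult.commute)

text \<open>The ideal may be improper, so this applies to principal ideals as well as to maximal
  ones.\<close>

lemma indicator_compl_mem_ideal:
  assumes I: "ideal I (ring_on M S)" and E: "E \<in> Z_sets M S f" and f: "f \<in> I"
  shows "restrict (indicator (space M - E)) (space M) \<in> I"
proof -
  obtain g where g: "g \<in> S" "\<And>x. x \<in> space M - E \<Longrightarrow> f x * g x = 1" and "E \<in> sets M"
    using E unfolding Z_sets_def by blast
  then have ge: "g \<otimes>\<^bsub>ring_on M S\<^esub> restrict (indicator (space M - E)) (space M) \<in> carrier (ring_on M S)"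
    by (intro m_closed) (auto simp: ring_on_simps(1) intro!: chi_ring_indicator)
  show ?thesis
    by (subst indicator_eq_mult[of "space M - E" f g])
      (use g(2) ideal.I_l_closed[OF I f ge] in auto)
qed

text \<open>Translates set families into idempotents. For the converse, the indicator is its own
  inverse off \<open>E\<close>.\<close>

lemma mem_Z_family_iff:
  assumes I: "ideal I (ring_on M S)" and E: "E \<in> sets M"
  shows "E \<in> Z_family M S I \<longleftrightarrow> restrict (indicator (space M - E)) (space M) \<in> I" (is "_ \<longleftrightarrow> ?e \<in> I")
proof
  assume "E \<in> Z_family M S I"
  then show "?e \<in> I"
    using indicator_compl_mem_ideal[OF I] unfolding Z_family_def by blast
next
  assume "?e \<in> I"
  moreover have "E \<in> Z_sets M S ?e"
    unfolding Z_sets_def using E chi_ring_indicator[of "space M - E"] by (auto intro!: bexI[of _ ?e])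
  ultimately show "E \<in> Z_family M S I"
    unfolding Z_family_def by blast
qed

section \<open>The two implications\<close>

lemma gelfand_if_maximal_Z_ideals:
  assumes Z: "\<And>N. maximalideal N (ring_on M S) \<Longrightarrow> Z_ideal M S N"
  shows "gelfand_ring (ring_on M S)"
proof (rule gelfand_if_idempotent_separation)
  fix N f assume N: "maximalideal N (ring_on M S)"
    and f: "f \<in> carrier (ring_on M S)" "f \<notin> N"
  have NI: "ideal N (ring_on M S)" using N by (rule maximalideal.axioms)
  have "\<not> Z_sets M S f \<subseteq> Z_family M S N"
    using Z[OF N] f unfolding Z_ideal_def ring_on_simps(1) by blast
  then obtain E where E: "E \<in> Z_sets M S f" "E \<notin> Z_family M S N" by blast
  let ?e = "restrict (indicator (space M - E)) (space M) :: 'a \<Rightarrow> real"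
  have "?e \<notin> N"
    using E mem_Z_family_iff[OF NI] unfolding Z_sets_def by blast
  moreover have "?e \<in> PIdl\<^bsub>ring_on M S\<^esub> f"
    using indicator_compl_mem_ideal[OF cgenideal_ideal[OF f(1)] E(1) cgenideal_self[OF f(1)]] .
  moreover have "?e \<otimes>\<^bsub>ring_on M S\<^esub> ?e = ?e"
    unfolding ring_on_simps by (auto simp: indicator_def)
  ultimately show "\<exists>e\<in>PIdl\<^bsub>ring_on M S\<^esub> f. e \<otimes>\<^bsub>ring_on M S\<^esub> e = e \<and> e \<notin> N" by blast
qed

lemma maximal_Z_ideal_if_gelfand:
  assumes gelfand: "gelfand_ring (ring_on M S)" and N: "maximalideal N (ring_on M S)"
  shows "Z_ideal M S N"
proof -
  interpret N: maximalideal N "ring_on M S" by (rule N)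
  have "f \<in> N" if f: "f \<in> S" and sub: "Z_sets M S f \<subseteq> Z_family M S N" for f
  proof (rule ccontr)
    assume fN: "f \<notin> N"
    have fc: "f \<in> carrier (ring_on M S)" using f by (simp add: ring_on_simps(1))
    note I = cgenideal_ideal[OF fc]
    let ?K = "PIdl\<^bsub>ring_on M S\<^esub> f <+>\<^bsub>ring_on M S\<^esub> N"
    have K: "ideal ?K (ring_on M S)" by (rule add_ideals[OF I N.is_ideal])
    \<comment> \<open>The sum contains \<open>f\<close>, which is not in \<open>N\<close>;
      maximality then makes it the whole ring.\<close>
    have "N \<subseteq> ?K" "?K \<noteq> N"
      using subset_add_ideals[OF I N.is_ideal] cgenideal_self[OF fc] fN by auto
    then have "?K = carrier (ring_on M S)"
      using N.I_maximal[OF K] additive_subgroup.a_subset[OF ideal.axioms(1)[OF K]] by blast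
    then have "\<one>\<^bsub>ring_on M S\<^esub> \<in> ?K" by (metis one_closed)
    then obtain u i v j where u: "i \<in> PIdl\<^bsub>ring_on M S\<^esub> f" "u \<oplus>\<^bsub>ring_on M S\<^esub> i = \<one>\<^bsub>ring_on M S\<^esub>"
      and v: "v \<in> carrier (ring_on M S)" "j \<in> N" "v \<oplus>\<^bsub>ring_on M S\<^esub> j = \<one>\<^bsub>ring_on M S\<^esub>"
      and uv: "u \<otimes>\<^bsub>ring_on M S\<^esub> v = \<zero>\<^bsub>ring_on M S\<^esub>"
      using gelfand_comaximal[OF gelfand I N.is_ideal] by metis
    obtain g where g: "g \<in> S" "i = g \<otimes>\<^bsub>ring_on M S\<^esub> f"
      using u(1) unfolding cgenideal_def ring_on_simps(1) by blast
    have vS: "v \<in> S" using v(1) by (simp add: ring_on_simps(1))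
    \<comment> \<open>Off this zero set \<open>u\<close> must vanish, so that \<open>i\<close>, a
      multiple of \<open>f\<close>, equals 1 there.\<close>
    define E where "E = {x \<in> space M. v x = 0}"
    have [measurable]: "v \<in> borel_measurable M" using vS chi_ring_subset by blast
    have E: "E \<in> sets M" unfolding E_def by measurable
    let ?e = "restrict (indicator (space M - E)) (space M) :: 'a \<Rightarrow> real"
    have "f x * g x = 1" if x: "x \<in> space M - E" for x
    proof -
      have "u x * v x = 0"
        using fun_cong[OF uv[unfolded ring_on_simps], of x] x by simp
      then have "u x = 0" using x by (simp add: E_def)
      then show ?thesis
        using fun_cong[OF u(2)[unfolded g(2) ring_on_simps], of x] x by (simp add: mult.commute)
    qed
    then have "E \<in> Z_sets M S f"
      unfolding Z_sets_def using E g(1) by blast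
    then have eN: "?e \<in> N"
      using sub mem_Z_family_iff[OF N.is_ideal E] by blast
    \<comment> \<open>On \<open>E\<close> both sides are 0, and outside \<open>space M\<close> both
      are \<open>undefined\<close>. Hence \<open>v\<close> lies in \<open>N\<close>, and so does
      \<one> = v + j.\<close>
    have "v = v \<otimes>\<^bsub>ring_on M S\<^esub> ?e"
    proof
      fix x show "v x = (v \<otimes>\<^bsub>ring_on M S\<^esub> ?e) x"
        unfolding ring_on_simps using vS chi_ring_subset
        by (auto simp: E_def indicator_def extensional_def)
    qed
    then have "v \<in> N" using N.I_l_closed[OF eN v(1)] by simp
    then have "\<one>\<^bsub>ring_on M S\<^esub> \<in> N" using v N.a_closed by metis
    then show False using N.I_notcarr N.one_imp_carrier by metis
  qed
  then show ?thesis
    unfolding Z_ideal_def using N.is_ideal N.I_notcarr by (auto simp: ring_on_simps(1))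
qed

end

theorem theorem4p2:
  fixes M :: "'a measure" and S :: "('a \<Rightarrow> real) set"
  assumes "space M \<noteq> {}"
    and "chi_ring M S"
  shows "(\<forall>N. maximalideal N (ring_on M S) \<longrightarrow> Z_ideal M S N) \<longleftrightarrow> gelfand_ring (ring_on M S)"
  using gelfand_if_maximal_Z_ideals[OF assms(2)] maximal_Z_ideal_if_gelfand[OF assms(2)] by blast

end
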